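(* (Family $(-,-,5/2)$, Painlevé I.) Let $p,q$ be holomorphic functions of $t$ on a connected open set $U\subset\mathbb{C}$. Put $$A=\begin{pmatrix}p&q^2+zq+z^2+t\\ z-q&-p\end{pmatrix},\qquad B=\begin{pmatrix}0&2q\\ 1&0\end{pmatrix}+z\begin{pmatrix}0&1\\ 0&0\end{pmatrix}.$$ Then the operators $\frac{d}{dz}+A$ and $\frac{d}{dt}+B$ commute if and only if $$\frac{dq}{dt}=2p,\qquad\frac{dp}{dt}=3q^2+t .$$ This system is the Hamiltonian system $\frac{dq}{dt}=-\frac{\partial H}{\partial p}$, $\frac{dp}{dt}=\frac{\partial H}{\partial q}$ with $H=-p^2+q^3+tq$, and, with $p=\frac12q'$, it is equivalent to $q''=6q^2+2t$.
   Context: Operators act on vector-valued functions of $(z,t)$; $\frac{d}{dz},\frac{d}{dt}$ are the partial derivatives. Two operators $\frac{d}{dz}+A$ and $\frac{d}{dt}+B$ with matrix functions $A(z,t),B(z,t)$ commute iff $\frac{\partial A}{\partial t}=\frac{\partial B}{\partial z}+AB-BA$ identically in $z,t$. In the Hamiltonian equations $H=H(p,q,t)$ with partial derivatives in the independent variables $p,q,t$; $'$ denotes $\frac{d}{dt}$. (This commutation is the isomonodromy condition for the family of connections.) *)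

theory Defs
  imports "HOL-Complex_Analysis.Complex_Analysis"
begin

text \<open>
  Holomorphy in two complex variables: the total derivative exists at every point of the domain and
  is complex linear.
\<close>

definition holomorphic2_on :: "(complex \<Rightarrow> complex \<Rightarrow> complex) \<Rightarrow> (complex \<times> complex) set \<Rightarrow> bool"
  where "holomorphic2_on f W \<longleftrightarrow>
    (\<forall>(z, t) \<in> W. \<exists>a b. ((\<lambda>(x, y). f x y) has_derivative (\<lambda>(h, k). a * h + b * k)) (at (z, t)))"

type_synonym 'n vector_function = "complex \<Rightarrow> complex \<Rightarrow> complex ^ 'n"
type_synonym 'n matrix_function = "complex \<Rightarrow> complex \<Rightarrow> complex ^ 'n ^ 'n"

definition connection_z :: "'n::finite matrix_function \<Rightarrow> 'n vector_function \<Rightarrow> 'n vector_function"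
  where "connection_z A Y = (\<lambda>z t. (\<chi> i. deriv (\<lambda>x. Y x t $ i) z) + A z t *v Y z t)"

definition connection_t :: "'n::finite matrix_function \<Rightarrow> 'n vector_function \<Rightarrow> 'n vector_function"
  where "connection_t B Y = (\<lambda>z t. (\<chi> i. deriv (\<lambda>s. Y z s $ i) t) + B z t *v Y z t)"

text \<open>
  The operators d/dz + A and d/dt + B commute on the holomorphic vector functions on W.
\<close>

definition connections_commute_on ::
  "(complex \<times> complex) set \<Rightarrow> 'n::finite matrix_function \<Rightarrow> 'n matrix_function \<Rightarrow> bool"
  where "connections_commute_on W A B \<longleftrightarrow>
    (\<forall>Y. (\<forall>i. holomorphic2_on (\<lambda>z t. Y z t $ i) W) \<longrightarrow>
      (\<forall>(z, t) \<in> W.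
        connection_z A (connection_t B Y) z t = connection_t B (connection_z A Y) z t))"

text \<open>
  The Lax pair. The matrix \<open>mat z\<close> is z times the identity.
\<close>

definition lax_A :: "(complex \<Rightarrow> complex) \<Rightarrow> (complex \<Rightarrow> complex) \<Rightarrow> 2 matrix_function"
  where "lax_A p q = (\<lambda>z t.
    vector [vector [p t, (q t)\<^sup>2 + z * q t + z\<^sup>2 + t],
            vector [z - q t, - p t]])"

definition lax_B :: "(complex \<Rightarrow> complex) \<Rightarrow> 2 matrix_function"
  where "lax_B q = (\<lambda>z t.
    vector [vector [0, 2 * q t], vector [1, 0]] + mat z ** vector [vector [0, 1], vector [0, 0]])"

definition painleve1_system ::
  "complex set \<Rightarrow> (complex \<Rightarrow> complex) \<Rightarrow> (complex \<Rightarrow> complex) \<Rightarrow> bool"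
  where "painleve1_system U p q \<longleftrightarrow>
    (\<forall>t \<in> U. deriv q t = 2 * p t \<and> deriv p t = 3 * (q t)\<^sup>2 + t)"

text \<open>
  The sign convention is q' = - dH/dp and p' = dH/dq; the derivatives of H are partial ones, with p,
  q and t independent.
\<close>

definition hamiltonian_system ::
  "(complex \<Rightarrow> complex \<Rightarrow> complex \<Rightarrow> complex) \<Rightarrow>
    complex set \<Rightarrow> (complex \<Rightarrow> complex) \<Rightarrow> (complex \<Rightarrow> complex) \<Rightarrow> bool"
  where "hamiltonian_system H U p q \<longleftrightarrow>
    (\<forall>t \<in> U. deriv q t = - deriv (\<lambda>x. H x (q t) t) (p t) \<and>
             deriv p t = deriv (\<lambda>y. H (p t) y t) (q t))"

definition painleve1_H :: "complex \<Rightarrow> complex \<Rightarrow> complex \<Rightarrow> complex"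
  where "painleve1_H p q t = - p\<^sup>2 + q ^ 3 + t * q"

end

(*
  For every holomorphic Y, the commutator of d/dz + A and d/dt + B applied to Y is
  (B_z - A_t + AB - BA) Y: the second derivatives cancel because the mixed partial derivatives of a
  holomorphic function of two variables exist and agree. To see this, write f_z as a Cauchy integral
  over a circle in the z-plane and differentiate in t under the integral sign. Testing on constant Y
  shows that the operators commute iff A_t = B_z + AB - BA, and for the Lax pair
  the entries of this matrix equation reduce to the Painleve I system.
*)
theory Submission
  imports Defs
begin

(* Otherwise every component selection v $ i doubles the number of parse trees. *)
no_notation fps_nth (infixl "$" 75)

section \<open>Cauchy's formula for the derivative as an integral over a fixed interval\<close>

lemma contour_integral_circlepath_integral:
  "contour_integral (circlepath z r) f =
    integral (cbox 0 1) (\<lambda>s. f (circlepath z r s) * (2 * pi * \<i> * r * exp (2 * pi * \<i> * s)))"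
  unfolding contour_integral_integral vector_derivative_circlepath by simp

text \<open>Cauchy's formula for the first derivative, with the circle parametrised over the fixed
  interval \<open>cbox 0 1\<close>. Dependence on \<open>z\<close> or on a parameter in
  \<open>f\<close> then sits in the integrand alone, where theorems on parameter integrals apply.
  The centre \<open>z0\<close> is kept apart from \<open>z\<close> so that one circle serves all
  points of the ball.\<close>

lemma deriv_eq_integral_circlepath:
  assumes "cball z0 r \<subseteq> S" "f holomorphic_on S" "z \<in> ball z0 r"
  shows "deriv f z = integral (cbox 0 1) (\<lambda>s. f (circlepath z0 r s) / (circlepath z0 r s - z)\<^sup>2 *
    (2 * pi * \<i> * r * exp (2 * pi * \<i> * s))) / (2 * pi * \<i>)"
proof -
  have "f holomorphic_on cball z0 r"
    using assms holomorphic_on_subset by blast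
  then have "contour_integral (circlepath z0 r) (\<lambda>u. f u / (u - z)\<^sup>2) = (2 * pi * \<i>) * deriv f z"
    using assms ball_subset_cball
    by (intro Cauchy_contour_integral_circlepath_2)
      (auto intro: holomorphic_on_imp_continuous_on holomorphic_on_subset)
  then show ?thesis
    by (simp add: contour_integral_circlepath_integral)
qed

lemma circlepath_mem_cball: "r \<ge> 0 \<Longrightarrow> circlepath z r s \<in> cball z r"
  by (auto simp: circlepath dist_norm norm_mult)

lemma circlepath_neq_ball: "r \<ge> 0 \<Longrightarrow> w \<in> ball z r \<Longrightarrow> circlepath z r s \<noteq> w"
  by (auto simp: circlepath dist_norm norm_mult)

lemma continuous_on_circlepath [continuous_intros]:
  "continuous_on A g \<Longrightarrow> continuous_on A (\<lambda>x. circlepath z r (g x))"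
  unfolding circlepath by (intro continuous_intros)

section \<open>Joint continuity of partial derivatives and symmetry of the mixed ones\<close>

lemma continuous_on_swap_args:
  assumes "continuous_on (S \<times> T) (\<lambda>(z, t). f z t)"
  shows "continuous_on (T \<times> S) (\<lambda>(t, z). f z t)"
  unfolding split_beta
  by (rule continuous_on_compose2[OF assms, where f = "\<lambda>x. (snd x, fst x)",
        unfolded split_beta fst_conv snd_conv]) (auto intro!: continuous_intros)

text \<open>Continuity is local: on a ball about \<open>z0\<close> the derivative is an integral
  over one fixed circle, and the integrand is jointly continuous in the point, the parameter
  \<open>t\<close> and the path parameter \<open>s\<close>. Since \<open>t\<close> enters only
  through continuity, it may range over any Hausdorff space.\<close>

lemma continuous_on_partial_deriv:
  fixes f :: "complex \<Rightarrow> 'a::t2_space \<Rightarrow> complex"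
  assumes "open S" "open T"
    and cont: "continuous_on (S \<times> T) (\<lambda>(z, t). f z t)"
    and hol: "\<And>t. t \<in> T \<Longrightarrow> (\<lambda>z. f z t) holomorphic_on S"
  shows "continuous_on (S \<times> T) (\<lambda>(z, t). deriv (\<lambda>x. f x t) z)"
proof -
  have "isCont (\<lambda>(z, t). deriv (\<lambda>x. f x t) z) (z0, t0)" if zt: "z0 \<in> S" "t0 \<in> T" for z0 t0
  proof -
    obtain r where r: "r > 0" "cball z0 r \<subseteq> S"
      using \<open>open S\<close> zt open_contains_cball by blast
    let ?W = "ball z0 r \<times> T"
    have cont_f: "continuous_on (?W \<times> cbox 0 1) (\<lambda>x. f (circlepath z0 r (snd x)) (snd (fst x)))"
      using r circlepath_mem_cball[of r z0]
      by (intro continuous_on_compose2[OF cont, where f = "\<lambda>x. (circlepath z0 r (snd x), snd (fst x))",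
            unfolded split_beta fst_conv snd_conv] continuous_intros) (auto simp: less_imp_le subset_iff)
    \<comment> \<open>The denominator never vanishes: \<open>fst w\<close> lies in the open ball and
      the circle is its boundary.\<close>
    have "continuous_on (?W \<times> cbox 0 1) (\<lambda>(w, s).
        f (circlepath z0 r s) (snd w) / (circlepath z0 r s - fst w)\<^sup>2 *
        (2 * pi * \<i> * r * exp (2 * pi * \<i> * of_real s)))"
      unfolding split_beta using r circlepath_neq_ball[of r _ z0]
      by (intro continuous_intros cont_f) (auto simp: less_imp_le)
    then have *: "continuous_on ?W (\<lambda>w. integral (cbox 0 1) (\<lambda>s.
        f (circlepath z0 r s) (snd w) / (circlepath z0 r s - fst w)\<^sup>2 *
        (2 * pi * \<i> * r * exp (2 * pi * \<i> * of_real s))) / (2 * pi * \<i>))"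
      by (intro continuous_intros integral_continuous_on_param) auto
    have "continuous_on ?W (\<lambda>(z, t). deriv (\<lambda>x. f x t) z)"
      by (rule continuous_on_eq[OF *]) (auto simp: deriv_eq_integral_circlepath[OF r(2) hol])
    moreover have "open ?W" "(z0, t0) \<in> ?W"
      using r zt \<open>open T\<close> by (auto intro: open_Times)
    ultimately show ?thesis
      using continuous_on_eq_continuous_at by blast
  qed
  then show ?thesis
    by (auto intro: continuous_at_imp_continuous_on)
qed

text \<open>Differentiation under the integral sign in Cauchy's formula. The result is left as an
  explicit integral so that it can afterwards be recognised as Cauchy's formula for the function
  \<open>deriv (f x) t\<close> of \<open>x\<close>.\<close>

lemma has_field_derivative_partial_deriv:
  assumes "open S" "open T"
    and cont: "continuous_on (S \<times> T) (\<lambda>(z, t). f z t)"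
    and hol1: "\<And>t. t \<in> T \<Longrightarrow> (\<lambda>z. f z t) holomorphic_on S"
    and hol2: "\<And>z. z \<in> S \<Longrightarrow> (\<lambda>t. f z t) holomorphic_on T"
    and r: "r > 0" "cball z r \<subseteq> S" and t: "t \<in> T"
  shows "((\<lambda>s. deriv (\<lambda>x. f x s) z) has_field_derivative
    integral (cbox 0 1) (\<lambda>s. deriv (f (circlepath z r s)) t / (circlepath z r s - z)\<^sup>2 *
      (2 * pi * \<i> * r * exp (2 * pi * \<i> * of_real s))) / (2 * pi * \<i>)) (at t)"
proof -
  \<comment> \<open>The Leibniz rule asks for a convex parameter set, hence a ball inside
    \<open>T\<close>.\<close>
  obtain d where d: "d > 0" "ball t d \<subseteq> T"
    using \<open>open T\<close> t open_contains_ball by blast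
  have mem: "circlepath z r s \<in> S" for s
    using circlepath_mem_cball[of r z s] r by auto
  have neq: "circlepath z r s \<noteq> z" for s
    using circlepath_neq_ball[of r z z s] r by auto
  \<comment> \<open>The Leibniz rule also needs the \<open>t\<close>-derivative of the integrand to
    be jointly continuous. This is the preceding continuity result with the two variables
    exchanged.\<close>
  have "continuous_on (T \<times> S) (\<lambda>(t, z). f z t)"
    using cont by (rule continuous_on_swap_args)
  then have contt: "continuous_on (T \<times> S) (\<lambda>(t, z). deriv (\<lambda>s. f z s) t)"
    using assms by (intro continuous_on_partial_deriv) auto
  let ?F = "\<lambda>t s. f (circlepath z r s) t / (circlepath z r s - z)\<^sup>2 *
      (2 * pi * \<i> * r * exp (2 * pi * \<i> * of_real s))"
  let ?G = "\<lambda>t s. deriv (f (circlepath z r s)) t / (circlepath z r s - z)\<^sup>2 *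
      (2 * pi * \<i> * r * exp (2 * pi * \<i> * of_real s))"
  have "((\<lambda>t. integral (cbox 0 1) (?F t)) has_field_derivative integral (cbox 0 1) (?G t))
      (at t within ball t d)"
  proof (rule leibniz_rule_field_derivative)
    fix x and s :: real assume x: "x \<in> ball t d"
    then have "(f (circlepath z r s) has_field_derivative deriv (f (circlepath z r s)) x)
        (at x within ball t d)"
      using holomorphic_derivI[OF hol2[OF mem] \<open>open T\<close>] d by blast
    then show "((\<lambda>x. ?F x s) has_field_derivative ?G x s) (at x within ball t d)"
      by (intro DERIV_cmult_right DERIV_cdivide)
  next
    fix x assume x: "x \<in> ball t d"
    then have "continuous_on (cbox 0 1) (\<lambda>s. f (circlepath z r s) x)"
      using d mem by (intro continuous_on_compose2[OF cont, where f = "\<lambda>s. (circlepath z r s, x)",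
          unfolded split_beta fst_conv snd_conv] continuous_intros) auto
    then show "?F x integrable_on cbox 0 1"
      using neq by (intro integrable_continuous continuous_intros) auto
  next
    have "continuous_on (ball t d \<times> cbox 0 1) (\<lambda>x. deriv (f (circlepath z r (snd x))) (fst x))"
      using d mem
      by (intro continuous_on_compose2[OF contt, where f = "\<lambda>x. (fst x, circlepath z r (snd x))",
          unfolded split_beta fst_conv snd_conv] continuous_intros) auto
    then show "continuous_on (ball t d \<times> cbox 0 1) (\<lambda>(x, s). ?G x s)"
      using neq unfolding split_beta by (intro continuous_intros) auto
  qed (use d in auto)
  then have "((\<lambda>t. integral (cbox 0 1) (?F t)) has_field_derivative integral (cbox 0 1) (?G t)) (at t)"
    using d by (simp only: at_within_open centre_in_ball open_ball)
  then have "((\<lambda>t. integral (cbox 0 1) (?F t) / (2 * pi * \<i>)) has_field_derivative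
      integral (cbox 0 1) (?G t) / (2 * pi * \<i>)) (at t)"
    by (rule DERIV_cdivide)
  then show ?thesis
  \<comment> \<open>Cauchy's formula identifies the parameter integral with the inner partial
    derivative for every parameter in the open set \<open>T\<close>, so the derivative carries
    over.\<close>
  proof (rule has_field_derivative_transform_within_open)
    fix s assume "s \<in> T"
    then show "integral (cbox 0 1) (?F s) / (2 * pi * \<i>) = deriv (\<lambda>x. f x s) z"
      using r by (intro deriv_eq_integral_circlepath[OF r(2) hol1, symmetric]) auto
  qed (use t \<open>open T\<close> in auto)
qed

text \<open>Both orders of differentiation lead to the same Cauchy integral: one by differentiating
  under the integral sign, the other by Cauchy's formula applied to the
  \<open>t\<close>-derivative.\<close>

lemma has_field_derivative_partial_deriv_swap:
  assumes "open S" "open T"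
    and cont: "continuous_on (S \<times> T) (\<lambda>(z, t). f z t)"
    and hol1: "\<And>t. t \<in> T \<Longrightarrow> (\<lambda>z. f z t) holomorphic_on S"
    and hol2: "\<And>z. z \<in> S \<Longrightarrow> (\<lambda>t. f z t) holomorphic_on T"
    and z: "z \<in> S" and t: "t \<in> T"
  shows "((\<lambda>s. deriv (\<lambda>x. f x s) z) has_field_derivative deriv (\<lambda>x. deriv (f x) t) z) (at t)"
proof -
  obtain r where r: "r > 0" "cball z r \<subseteq> S"
    using \<open>open S\<close> z open_contains_cball by blast
  have cont': "continuous_on (T \<times> S) (\<lambda>(t, z). f z t)"
    using cont by (rule continuous_on_swap_args)
  \<comment> \<open>Cauchy's formula can be applied to the \<open>t\<close>-derivative only once it
    is known to be holomorphic in \<open>x\<close>; differentiation under the integral with the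
    roles of \<open>S\<close> and \<open>T\<close> exchanged provides this.\<close>
  have "(\<lambda>x. deriv (f x) t) holomorphic_on S"
    unfolding holomorphic_on_open[OF \<open>open S\<close>]
  proof
    fix x assume x: "x \<in> S"
    obtain d where "d > 0" "cball t d \<subseteq> T"
      using \<open>open T\<close> t open_contains_cball by blast
    from has_field_derivative_partial_deriv[OF \<open>open T\<close> \<open>open S\<close> cont' hol2 hol1 this x]
    show "\<exists>D. ((\<lambda>x. deriv (f x) t) has_field_derivative D) (at x)"
      by blast
  qed
  from has_field_derivative_partial_deriv[OF assms(1-5) r t]
    deriv_eq_integral_circlepath[OF r(2) this, of z] r
  show ?thesis by simp
qed

section \<open>Consequences of holomorphy in two variables\<close>

lemma holomorphic2_on_imp_continuous_on:
  assumes "holomorphic2_on f W"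
  shows "continuous_on W (\<lambda>(z, t). f z t)"
proof (rule continuous_at_imp_continuous_on, rule ballI)
  fix w assume "w \<in> W"
  then show "isCont (\<lambda>(z, t). f z t) w"
    using assms unfolding holomorphic2_on_def by (fastforce intro: has_derivative_continuous)
qed

text \<open>Composing with the embedding of a horizontal line leaves only the summand
  \<open>a * h\<close> of the total derivative. Complex linearity makes \<open>a\<close> a complex
  derivative.\<close>

lemma holomorphic2_on_imp_holomorphic_on_fst:
  assumes "holomorphic2_on f (S \<times> T)" "open S" "t \<in> T"
  shows "(\<lambda>z. f z t) holomorphic_on S"
  unfolding holomorphic_on_open[OF \<open>open S\<close>]
proof
  fix z assume "z \<in> S"
  then obtain a b where
    "((\<lambda>(x, y). f x y) has_derivative (\<lambda>(h, k). a * h + b * k)) (at (z, t))"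
    using assms unfolding holomorphic2_on_def by fastforce
  moreover have "((\<lambda>x. (x, t)) has_derivative (\<lambda>h. (h, 0))) (at z)"
    by (auto intro!: derivative_eq_intros)
  ultimately have "((\<lambda>x. f x t) has_derivative (\<lambda>h. a * h)) (at z)"
    by (auto dest: has_derivative_compose[of "\<lambda>x. (x, t)" "\<lambda>h. (h, 0)" z UNIV "\<lambda>(x, y). f x y"])
  then show "\<exists>D. ((\<lambda>x. f x t) has_field_derivative D) (at z)"
    unfolding has_field_derivative_def by blast
qed

lemma holomorphic2_on_imp_holomorphic_on_snd:
  assumes "holomorphic2_on f (S \<times> T)" "open T" "z \<in> S"
  shows "(\<lambda>t. f z t) holomorphic_on T"
  unfolding holomorphic_on_open[OF \<open>open T\<close>]
proof
  fix t assume "t \<in> T"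
  then obtain a b where
    "((\<lambda>(x, y). f x y) has_derivative (\<lambda>(h, k). a * h + b * k)) (at (z, t))"
    using assms unfolding holomorphic2_on_def by fastforce
  moreover have "((\<lambda>y. (z, y)) has_derivative (\<lambda>k. (0, k))) (at t)"
    by (auto intro!: derivative_eq_intros)
  ultimately have "((\<lambda>y. f z y) has_derivative (\<lambda>k. b * k)) (at t)"
    by (auto dest: has_derivative_compose[of "\<lambda>y. (z, y)" "\<lambda>k. (0, k)" t UNIV "\<lambda>(x, y). f x y"])
  then show "\<exists>D. ((\<lambda>y. f z y) has_field_derivative D) (at t)"
    unfolding has_field_derivative_def by blast
qed

lemma holomorphic2_on_const: "holomorphic2_on (\<lambda>z t. c) W"
  unfolding holomorphic2_on_def
  using has_derivative_const[of c] by (auto intro!: exI[of _ 0] simp: case_prod_unfold)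

lemma holomorphic2_on_has_mixed_derivative:
  assumes "open S" "open T" "holomorphic2_on f (S \<times> T)" "z \<in> S" "t \<in> T"
  shows "((\<lambda>s. deriv (\<lambda>x. f x s) z) has_field_derivative deriv (\<lambda>x. deriv (f x) t) z) (at t)"
    and "((\<lambda>x. deriv (f x) t) has_field_derivative deriv (\<lambda>x. deriv (f x) t) z) (at z)"
proof -
  note cont = holomorphic2_on_imp_continuous_on[OF assms(3)]
  note hol = holomorphic2_on_imp_holomorphic_on_fst[OF assms(3,1)]
    holomorphic2_on_imp_holomorphic_on_snd[OF assms(3,2)]
  show "((\<lambda>s. deriv (\<lambda>x. f x s) z) has_field_derivative deriv (\<lambda>x. deriv (f x) t) z) (at t)"
    using has_field_derivative_partial_deriv_swap[OF assms(1,2) cont hol assms(4,5)] .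
  have cont': "continuous_on (T \<times> S) (\<lambda>(t, z). f z t)"
    using cont by (rule continuous_on_swap_args)
  note swap = has_field_derivative_partial_deriv_swap[where f = "\<lambda>t z. f z t",
      OF assms(2,1) cont' hol(2,1) assms(5,4)]
  \<comment> \<open>The exchanged statement gives the derivative as the other iterated one;
    \<open>DERIV_imp_deriv\<close> turns it into the equality of the two mixed derivatives, which
    puts the value in the required form.\<close>
  show "((\<lambda>x. deriv (f x) t) has_field_derivative deriv (\<lambda>x. deriv (f x) t) z) (at z)"
    using swap by (simp add: DERIV_imp_deriv[OF swap])
qed

section \<open>The commutator of two connections and zero curvature\<close>

lemma connection_t_eq_connection_z:
  "connection_t B Y z t = connection_z (\<lambda>t z. B z t) (\<lambda>t z. Y z t) t z"
  by (simp add: connection_t_def connection_z_def)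

text \<open>The product rule applied to \<open>B *v Y\<close>. Of the five summands, the mixed
  derivative and the two with a first derivative of \<open>Y\<close> recur in the opposite order of
  composition, so only the second and the last survive in the commutator.\<close>

lemma connection_z_connection_t:
  fixes A B :: "'n::finite matrix_function" and Y :: "'n vector_function"
  assumes Y: "\<And>i. (\<lambda>x. Y x t $ i) field_differentiable at z"
    and Y': "\<And>i. (\<lambda>x. deriv (\<lambda>s. Y x s $ i) t) field_differentiable at z"
    and B: "\<And>i j. (\<lambda>x. B x t $ i $ j) field_differentiable at z"
  shows "connection_z A (connection_t B Y) z t =
    (\<chi> i. deriv (\<lambda>x. deriv (\<lambda>s. Y x s $ i) t) z)
    + (\<chi> i j. deriv (\<lambda>x. B x t $ i $ j) z) *v Y z t
    + B z t *v (\<chi> i. deriv (\<lambda>x. Y x t $ i) z)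
    + A z t *v (\<chi> i. deriv (\<lambda>s. Y z s $ i) t)
    + (A z t ** B z t) *v Y z t"
proof -
  have "deriv (\<lambda>x. connection_t B Y x t $ i) z = deriv (\<lambda>x. deriv (\<lambda>s. Y x s $ i) t) z +
      (\<Sum>j\<in>UNIV. deriv (\<lambda>x. B x t $ i $ j) z * Y z t $ j) +
      (\<Sum>j\<in>UNIV. B z t $ i $ j * deriv (\<lambda>x. Y x t $ j) z)" for i
  proof (rule DERIV_imp_deriv)
    have "((\<lambda>x. B x t $ i $ j * Y x t $ j) has_field_derivative
        deriv (\<lambda>x. B x t $ i $ j) z * Y z t $ j + B z t $ i $ j * deriv (\<lambda>x. Y x t $ j) z) (at z)" for j
      using DERIV_mult[OF B[THEN DERIV_deriv_iff_field_differentiable[THEN iffD2]]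
          Y[THEN DERIV_deriv_iff_field_differentiable[THEN iffD2]], of i j j]
      by (simp add: algebra_simps)
    then have "((\<lambda>x. deriv (\<lambda>s. Y x s $ i) t + (\<Sum>j\<in>UNIV. B x t $ i $ j * Y x t $ j))
        has_field_derivative deriv (\<lambda>x. deriv (\<lambda>s. Y x s $ i) t) z +
        (\<Sum>j\<in>UNIV. deriv (\<lambda>x. B x t $ i $ j) z * Y z t $ j
          + B z t $ i $ j * deriv (\<lambda>x. Y x t $ j) z)) (at z)"
      by (intro DERIV_add DERIV_sum Y'[THEN DERIV_deriv_iff_field_differentiable[THEN iffD2]])
    then show "((\<lambda>x. connection_t B Y x t $ i) has_field_derivative
        deriv (\<lambda>x. deriv (\<lambda>s. Y x s $ i) t) z +
        (\<Sum>j\<in>UNIV. deriv (\<lambda>x. B x t $ i $ j) z * Y z t $ j) +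
        (\<Sum>j\<in>UNIV. B z t $ i $ j * deriv (\<lambda>x. Y x t $ j) z)) (at z)"
      by (simp add: connection_t_def matrix_vector_mult_def sum.distrib add.assoc)
  qed
  then have "(\<chi> i. deriv (\<lambda>x. connection_t B Y x t $ i) z) =
      (\<chi> i. deriv (\<lambda>x. deriv (\<lambda>s. Y x s $ i) t) z)
      + (\<chi> i j. deriv (\<lambda>x. B x t $ i $ j) z) *v Y z t
      + B z t *v (\<chi> i. deriv (\<lambda>x. Y x t $ i) z)"
    by (simp add: vec_eq_iff matrix_vector_mult_def)
  moreover have "A z t *v connection_t B Y z t =
      A z t *v (\<chi> i. deriv (\<lambda>s. Y z s $ i) t) + (A z t ** B z t) *v Y z t"
    by (simp add: connection_t_def matrix_vector_right_distrib matrix_vector_mul_assoc)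
  ultimately show ?thesis
    by (simp add: connection_z_def[of A] add.assoc)
qed

lemma connection_commutator:
  fixes A B :: "'n::finite matrix_function" and Y :: "'n vector_function"
  assumes "open S" "open T" and Y: "\<And>i. holomorphic2_on (\<lambda>z t. Y z t $ i) (S \<times> T)"
    and z: "z \<in> S" and t: "t \<in> T"
    and A: "\<And>i j. (\<lambda>s. A z s $ i $ j) field_differentiable at t"
    and B: "\<And>i j. (\<lambda>x. B x t $ i $ j) field_differentiable at z"
  shows "connection_z A (connection_t B Y) z t - connection_t B (connection_z A Y) z t =
    ((\<chi> i j. deriv (\<lambda>x. B x t $ i $ j) z) - (\<chi> i j. deriv (\<lambda>s. A z s $ i $ j) t)
      + A z t ** B z t - B z t ** A z t) *v Y z t"
proof -
  note mixed = holomorphic2_on_has_mixed_derivative[OF assms(1-3) z t]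
  have Yz: "(\<lambda>x. Y x t $ i) field_differentiable at z" for i
    using holomorphic2_on_imp_holomorphic_on_fst[OF Y \<open>open S\<close> t] \<open>open S\<close> z
    by (rule holomorphic_on_imp_differentiable_at)
  have Yt: "(\<lambda>s. Y z s $ i) field_differentiable at t" for i
    using holomorphic2_on_imp_holomorphic_on_snd[OF Y \<open>open T\<close> z] \<open>open T\<close> t
    by (rule holomorphic_on_imp_differentiable_at)
  have zt: "connection_z A (connection_t B Y) z t =
      (\<chi> i. deriv (\<lambda>x. deriv (\<lambda>s. Y x s $ i) t) z)
      + (\<chi> i j. deriv (\<lambda>x. B x t $ i $ j) z) *v Y z t
      + B z t *v (\<chi> i. deriv (\<lambda>x. Y x t $ i) z)
      + A z t *v (\<chi> i. deriv (\<lambda>s. Y z s $ i) t)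
      + (A z t ** B z t) *v Y z t"
    using mixed(2) B by (intro connection_z_connection_t Yz) (auto simp: field_differentiable_def)
  \<comment> \<open>The opposite order is the same expansion with the variables exchanged and
    \<open>A\<close> and \<open>B\<close> interchanged; \<open>connection_t_eq_connection_z\<close>
    translates it back below.\<close>
  have "connection_z (\<lambda>t z. B z t) (connection_t (\<lambda>t z. A z t) (\<lambda>t z. Y z t)) t z =
      (\<chi> i. deriv (\<lambda>s. deriv (\<lambda>x. Y x s $ i) z) t)
      + (\<chi> i j. deriv (\<lambda>s. A z s $ i $ j) t) *v Y z t
      + A z t *v (\<chi> i. deriv (\<lambda>s. Y z s $ i) t)
      + B z t *v (\<chi> i. deriv (\<lambda>x. Y x t $ i) z)
      + (B z t ** A z t) *v Y z t"
    using mixed(1) A by (intro connection_z_connection_t Yt) (auto simp: field_differentiable_def)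
  moreover have "deriv (\<lambda>s. deriv (\<lambda>x. Y x s $ i) z) t = deriv (\<lambda>x. deriv (\<lambda>s. Y x s $ i) t) z" for i
    using mixed(1) by (rule DERIV_imp_deriv)
  ultimately have tz: "connection_t B (connection_z A Y) z t =
      (\<chi> i. deriv (\<lambda>x. deriv (\<lambda>s. Y x s $ i) t) z)
      + (\<chi> i j. deriv (\<lambda>s. A z s $ i $ j) t) *v Y z t
      + A z t *v (\<chi> i. deriv (\<lambda>s. Y z s $ i) t)
      + B z t *v (\<chi> i. deriv (\<lambda>x. Y x t $ i) z)
      + (B z t ** A z t) *v Y z t"
    by (simp add: connection_t_eq_connection_z[abs_def])
  show ?thesis
    by (simp add: zt tz matrix_vector_mult_add_rdistrib matrix_vector_mult_diff_rdistrib)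
qed

text \<open>The commutator is multiplication by a matrix function, so it vanishes on all
  \<open>Y\<close> exactly when that matrix does. The entries of \<open>A\<close> are differentiated
  in \<open>t\<close> and those of \<open>B\<close> in \<open>z\<close>, as the two
  differentiability hypotheses provide.\<close>

theorem connections_commute_on_iff_zero_curvature:
  fixes A B :: "'n::finite matrix_function"
  assumes "open S" "open T"
    and A: "\<And>z t i j. z \<in> S \<Longrightarrow> t \<in> T \<Longrightarrow> (\<lambda>s. A z s $ i $ j) field_differentiable at t"
    and B: "\<And>z t i j. z \<in> S \<Longrightarrow> t \<in> T \<Longrightarrow> (\<lambda>x. B x t $ i $ j) field_differentiable at z"
  shows "connections_commute_on (S \<times> T) A B \<longleftrightarrow>
    (\<forall>z\<in>S. \<forall>t\<in>T. (\<chi> i j. deriv (\<lambda>s. A z s $ i $ j) t) =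
      (\<chi> i j. deriv (\<lambda>x. B x t $ i $ j) z) + A z t ** B z t - B z t ** A z t)"
    (is "?L \<longleftrightarrow> ?R")
proof
  assume L: ?L
  show ?R
  proof (intro ballI)
    fix z t assume zt: "z \<in> S" "t \<in> T"
    let ?M = "(\<chi> i j. deriv (\<lambda>x. B x t $ i $ j) z) - (\<chi> i j. deriv (\<lambda>s. A z s $ i $ j) t)
      + A z t ** B z t - B z t ** A z t"
    have "?M *v y = 0" for y
    proof -
      have hol: "holomorphic2_on (\<lambda>z t. (y :: complex^'n) $ i) (S \<times> T)" for i
        by (rule holomorphic2_on_const)
      then have "connection_z A (connection_t B (\<lambda>z t. y)) z t
          = connection_t B (connection_z A (\<lambda>z t. y)) z t"
        using L zt unfolding connections_commute_on_def by auto
      with connection_commutator[where Y = "\<lambda>z t. y" and A = A and B = B, OF assms(1,2) hol zt A[OF zt] B[OF zt]] show ?thesis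
        by simp
    qed
    then have "?M = 0"
      by (metis matrix_eq matrix_vector_mult_0)
    then show "(\<chi> i j. deriv (\<lambda>s. A z s $ i $ j) t) =
        (\<chi> i j. deriv (\<lambda>x. B x t $ i $ j) z) + A z t ** B z t - B z t ** A z t"
      by (simp add: algebra_simps)
  qed
next
  assume R: ?R
  show ?L
    unfolding connections_commute_on_def
  proof (intro allI impI, clarify)
    fix Y :: "'n vector_function" and z t
    assume hol: "\<forall>i. holomorphic2_on (\<lambda>z t. Y z t $ i) (S \<times> T)" and zt: "z \<in> S" "t \<in> T"
    from R zt have "(\<chi> i j. deriv (\<lambda>x. B x t $ i $ j) z) - (\<chi> i j. deriv (\<lambda>s. A z s $ i $ j) t)
        + A z t ** B z t - B z t ** A z t = 0"
      by (simp add: algebra_simps)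
    with connection_commutator[where Y = Y and A = A and B = B,
        OF assms(1,2) hol[rule_format] zt A[OF zt] B[OF zt]]
    show "connection_z A (connection_t B Y) z t = connection_t B (connection_z A Y) z t"
      by simp
  qed
qed

section \<open>The Lax pair of Painleve I\<close>

lemma lax_pair_commute_iff_painleve1:
  assumes "open U" and p: "p holomorphic_on U" and q: "q holomorphic_on U"
  shows "connections_commute_on (UNIV \<times> U) (lax_A p q) (lax_B q) \<longleftrightarrow> painleve1_system U p q"
proof -
  have dp: "(p has_field_derivative deriv p t) (at t)" and dq: "(q has_field_derivative deriv q t) (at t)"
    if "t \<in> U" for t
    using that assms holomorphic_derivI by blast+
  have dA: "((\<lambda>s. lax_A p q z s $ i $ j) has_field_derivative
      (vector [vector [deriv p t, 2 * q t * deriv q t + z * deriv q t + 1],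
        vector [- deriv q t, - deriv p t]] :: complex^2^2) $ i $ j) (at t)" if "t \<in> U" for z t i j
    using dp[OF that] dq[OF that] exhaust_2[of i] exhaust_2[of j]
    by (auto simp: lax_A_def intro!: derivative_eq_intros)
  have dB: "((\<lambda>x. lax_B q x t $ i $ j) has_field_derivative
      (vector [vector [0, 1], vector [0, 0]] :: complex^2^2) $ i $ j) (at z)" for z t i j
    using exhaust_2[of i] exhaust_2[of j]
    by (auto simp: lax_B_def matrix_matrix_mult_def sum_2 mat_def intro!: derivative_eq_intros)
  have "(\<lambda>s. lax_A p q z s $ i $ j) field_differentiable at t" if "t \<in> U" for z t i j
    unfolding field_differentiable_def by (rule exI, rule dA[OF that])
  moreover have "(\<lambda>x. lax_B q x t $ i $ j) field_differentiable at z" for z t i j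
    unfolding field_differentiable_def by (rule exI, rule dB)
  ultimately have "connections_commute_on (UNIV \<times> U) (lax_A p q) (lax_B q) \<longleftrightarrow>
    (\<forall>z\<in>UNIV. \<forall>t\<in>U. (\<chi> i j. deriv (\<lambda>s. lax_A p q z s $ i $ j) t) =
      (\<chi> i j. deriv (\<lambda>x. lax_B q x t $ i $ j) z)
      + lax_A p q z t ** lax_B q z t - lax_B q z t ** lax_A p q z t)"
    using \<open>open U\<close>
    by (intro connections_commute_on_iff_zero_curvature) auto
  \<comment> \<open>The equivalence holds for each fixed \<open>z\<close>, so the quantifier over
    \<open>z\<close> is carried along and dropped at the end, \<open>UNIV\<close> being
    nonempty.\<close>
  also have "\<dots> \<longleftrightarrow> (\<forall>z\<in>UNIV::complex set. \<forall>t\<in>U. deriv q t = 2 * p t \<and> deriv p t = 3 * (q t)\<^sup>2 + t)"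
  proof (intro ball_cong refl)
    fix z t assume t: "t \<in> U"
    have "(\<chi> i j. deriv (\<lambda>s. lax_A p q z s $ i $ j) t) =
        vector [vector [deriv p t, 2 * q t * deriv q t + z * deriv q t + 1],
          vector [- deriv q t, - deriv p t]]"
      using DERIV_imp_deriv[OF dA[OF t]] by (simp add: vec_eq_iff)
    moreover have "(\<chi> i j. deriv (\<lambda>x. lax_B q x t $ i $ j) z) = vector [vector [0, 1], vector [0, 0]]"
      using DERIV_imp_deriv[OF dB] by (simp add: vec_eq_iff)
    \<comment> \<open>In the diagonal entries all terms with \<open>z\<close> cancel:
      \<open>(2 * q t + z) * (z - q t)\<close> removes both \<open>z * q t\<close> and the square of
      \<open>z\<close>.\<close>
    moreover have "lax_A p q z t ** lax_B q z t - lax_B q z t ** lax_A p q z t =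
        vector [vector [3 * (q t)\<^sup>2 + t, 2 * p t * (2 * q t + z)],
          vector [- 2 * p t, - (3 * (q t)\<^sup>2 + t)]]"
      by (simp add: vec_eq_iff forall_2 lax_A_def lax_B_def matrix_matrix_mult_def sum_2 mat_def)
        (simp add: algebra_simps power2_eq_square)
    \<comment> \<open>The lower left entry gives \<open>deriv q t = 2 * p t\<close> and the diagonal
      gives the equation for \<open>p\<close>. The upper right entry is the former multiplied by
      \<open>2 * q t + z\<close>, with a 1 on both sides: from the explicit \<open>t\<close> in
      \<open>lax_A\<close> and from the \<open>z\<close>-derivative of \<open>lax_B\<close>. Hence
      it adds no condition.\<close>
    moreover have "1 + 2 * p t * (2 * q t + z) = 2 * q t * (2 * p t) + z * (2 * p t) + 1"
      by (simp add: algebra_simps)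
    ultimately show "((\<chi> i j. deriv (\<lambda>s. lax_A p q z s $ i $ j) t) =
        (\<chi> i j. deriv (\<lambda>x. lax_B q x t $ i $ j) z)
        + lax_A p q z t ** lax_B q z t - lax_B q z t ** lax_A p q z t) \<longleftrightarrow>
        deriv q t = 2 * p t \<and> deriv p t = 3 * (q t)\<^sup>2 + t"
      by (auto simp: vec_eq_iff forall_2 add_diff_eq[symmetric])
  qed
  finally show ?thesis
    by (simp add: painleve1_system_def)
qed

section \<open>The Hamiltonian form and the second-order equation\<close>

lemma painleve1_system_iff_hamiltonian:
  "painleve1_system U p q \<longleftrightarrow> hamiltonian_system painleve1_H U p q"
proof -
  have "deriv (\<lambda>x. painleve1_H x b t) a = - 2 * a" for a b t
    unfolding painleve1_H_def by (rule DERIV_imp_deriv) (auto intro!: derivative_eq_intros)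
  moreover have "deriv (\<lambda>y. painleve1_H a y t) b = 3 * b\<^sup>2 + t" for a b t
    unfolding painleve1_H_def by (rule DERIV_imp_deriv) (auto intro!: derivative_eq_intros)
  ultimately show ?thesis
    by (simp add: painleve1_system_def hamiltonian_system_def)
qed

text \<open>Once \<open>deriv q = 2 * p\<close> holds on the open set \<open>U\<close>, it can be
  differentiated there, and the second-order equation is twice the equation for
  \<open>deriv p\<close>.\<close>

lemma painleve1_system_iff_second_order:
  assumes "open U" and p: "p holomorphic_on U"
  shows "painleve1_system U p q \<longleftrightarrow> (\<forall>t\<in>U. p t = deriv q t / 2) \<and>
    (\<forall>t\<in>U. deriv (deriv q) t = 6 * (q t)\<^sup>2 + 2 * t)"
proof -
  have "deriv (deriv q) t = 2 * deriv p t" if "\<forall>t\<in>U. deriv q t = 2 * p t" "t \<in> U" for t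
  proof (rule DERIV_imp_deriv)
    have "((\<lambda>t. 2 * p t) has_field_derivative 2 * deriv p t) (at t)"
      using holomorphic_derivI[OF p \<open>open U\<close> \<open>t \<in> U\<close>] by (rule DERIV_cmult)
    then show "(deriv q has_field_derivative 2 * deriv p t) (at t)"
      using \<open>open U\<close> \<open>t \<in> U\<close> by (rule has_field_derivative_transform_within_open) (use that in auto)
  qed
  moreover have "2 * deriv p t = 6 * (q t)\<^sup>2 + 2 * t \<longleftrightarrow> deriv p t = 3 * (q t)\<^sup>2 + t" for t
  proof -
    have "6 * (q t)\<^sup>2 + 2 * t = 2 * (3 * (q t)\<^sup>2 + t)" by simp
    then show ?thesis by (simp only: mult_cancel_left) simp
  qed
  moreover have "p t = deriv q t / 2 \<longleftrightarrow> deriv q t = 2 * p t" for t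
    by (auto simp: field_simps)
  ultimately show ?thesis
    unfolding painleve1_system_def by (metis (no_types, lifting))
qed

theorem mainTheorem19:
  fixes p q :: "complex \<Rightarrow> complex" and U :: "complex set"
  assumes "open U" and "connected U"
    and "p holomorphic_on U" and "q holomorphic_on U"
  shows "(connections_commute_on (UNIV \<times> U) (lax_A p q) (lax_B q) \<longleftrightarrow> painleve1_system U p q)
    \<and> (painleve1_system U p q \<longleftrightarrow> hamiltonian_system painleve1_H U p q)
    \<and> (painleve1_system U p q \<longleftrightarrow>
        (\<forall>t \<in> U. p t = deriv q t / 2) \<and>
        (\<forall>t \<in> U. deriv (deriv q) t = 6 * (q t)\<^sup>2 + 2 * t))"
  using lax_pair_commute_iff_painleve1[OF assms(1,3,4)] painleve1_system_iff_hamiltonian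
    painleve1_system_iff_second_order[OF assms(1,3)]
  by blast

end
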